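(* Consider the minimum delay routing problem with mutual information accumulation (as defined in the context) for a line topology: the source $s$, the destination $d$ and the $n$ relay nodes are all located on a line, no two nodes are co-located, every node transmits at the same power spectral density, and the transmission capacity $C_{ij}$ between any two nodes $i$ and $j$ depends only on the distance $d_{ij}$ between them and is a (strictly) monotonically decreasing function of $d_{ij}$. Then the optimal cooperating set, i.e. the set $\mathcal{R}_{opt}$ of relay nodes taking part in the optimal solution, is the set of all relay nodes located between the source and the destination.
   Context: Network: a source $s$, a destination $d$, and $n$ relay nodes, with fixed link capacities $C_{ij}\ge 0$ (bandwidth normalized to $1$): if node $i$ transmits for a duration $\Delta$, every other node $j$ that does not yet have the packet accumulates $\Delta\, C_{ij}$ bits of mutual information, and contributions from different transmissions add up. A node can transmit only after it has decoded the packet, which requires accumulating at least $I_{max}>0$ bits. Initially only $s$ has the packet. Transmissions are orthogonal in time (at most one node transmits at any moment). A transmission strategy uses a subset $\mathcal{R}$ of the relays, $|\mathcal{R}|=k$, and an ordering $\mathcal{O}$ of $\mathcal{R}$ (the decoding order). Label the relays of $\mathcal{R}$ as $1,\ldots,k$ according to $\mathcal{O}$, the source as $0$ and the destination as $k+1$. Stage $j$ ($0\le j\le k$) is the time interval between the decoding time of node $j$ (the start time if $j=0$) and that of node $j+1$, with duration $\Delta_j$, and $A_{ij}$ is the transmission duration of node $i$ in stage $j$. For given $(\mathcal{R},\mathcal{O})$ the minimum delay is the value of the linear program $$\text{minimize } T_{tot}=\sum_{j=0}^k\Delta_j$$ subject to $$\sum_{i=0}^{m-1}\sum_{j=0}^{m-1}A_{ij}C_{im}\ge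 I_{max}\ \ \forall m\in\{1,\ldots,k+1\},\qquad \sum_{i=0}^{j}A_{ij}\le\Delta_j\ \ \forall j\in\{0,\ldots,k\},$$ $$A_{ij}\ge 0\ \ \forall i,j\in\{0,\ldots,k\},\qquad A_{ij}=0\ \ \forall i>j,\qquad \Delta_j\ge 0\ \ \forall j\in\{0,\ldots,k\}.$$ The minimum delay routing problem is to minimize $T_{tot}$ over all relay subsets $\mathcal{R}$ (including the empty set), all orderings $\mathcal{O}$ of $\mathcal{R}$, and all feasible $(A_{ij}),(\Delta_j)$. An optimal solution is a choice attaining this overall minimum. The set $\mathcal{R}_{opt}$ of relays taking part in an optimal solution is, by definition, such that each of its nodes transmits for a non-zero duration (a relay that never transmits can be removed from the set without affecting the minimum delay). *)

theory Defs
  imports "HOL-Analysis.Analysis"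
begin

text \<open>
  Common parameters: the relay nodes \<open>relays\<close>, the source \<open>s\<close>, the destination \<open>d\<close>,
  the link capacities \<open>C\<close> and the amount \<open>Imax\<close> of mutual information needed for decoding.
  A decoding order is a list \<open>xs\<close> of relays; node \<open>0\<close> is the source, node
  \<open>i \<in> {1..length xs}\<close> is the \<open>i\<close>-th relay of \<open>xs\<close>, node \<open>length xs + 1\<close> is the destination.
\<close>

definition node :: "'v \<Rightarrow> 'v \<Rightarrow> 'v list \<Rightarrow> nat \<Rightarrow> 'v" where
  "node s d xs i = (s # xs @ [d]) ! i"

text \<open>
  Constraints of the linear program for the order \<open>xs\<close>: \<open>A i j\<close> is the transmission duration of
  node \<open>i\<close> in stage \<open>j\<close>, and \<open>D j\<close> is the duration of stage \<open>j\<close>.  Only the values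
  at indices up to \<open>length xs\<close> are meaningful.
\<close>

definition lp_feasible ::
  "'v \<Rightarrow> 'v \<Rightarrow> ('v \<Rightarrow> 'v \<Rightarrow> real) \<Rightarrow> real \<Rightarrow> 'v list \<Rightarrow> (nat \<Rightarrow> nat \<Rightarrow> real) \<Rightarrow> (nat \<Rightarrow> real) \<Rightarrow> bool"
where
  "lp_feasible s d C Imax xs A D \<longleftrightarrow>
     (\<forall>m\<in>{1..length xs + 1}.
        (\<Sum>i=0..m-1. \<Sum>j=0..m-1. A i j * C (node s d xs i) (node s d xs m)) \<ge> Imax) \<and>
     (\<forall>j\<in>{0..length xs}. (\<Sum>i=0..j. A i j) \<le> D j) \<and>
     (\<forall>i\<in>{0..length xs}. \<forall>j\<in>{0..length xs}. A i j \<ge> 0) \<and>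
     (\<forall>i\<in>{0..length xs}. \<forall>j\<in>{0..length xs}. i > j \<longrightarrow> A i j = 0) \<and>
     (\<forall>j\<in>{0..length xs}. D j \<ge> 0)"

definition total_delay :: "'v list \<Rightarrow> (nat \<Rightarrow> real) \<Rightarrow> real" where
  "total_delay xs D = (\<Sum>j=0..length xs. D j)"

definition feasible_strategy ::
  "'v set \<Rightarrow> 'v \<Rightarrow> 'v \<Rightarrow> ('v \<Rightarrow> 'v \<Rightarrow> real) \<Rightarrow> real \<Rightarrow>
   'v set \<Rightarrow> 'v list \<Rightarrow> (nat \<Rightarrow> nat \<Rightarrow> real) \<Rightarrow> (nat \<Rightarrow> real) \<Rightarrow> bool"
where
  "feasible_strategy relays s d C Imax R xs A D \<longleftrightarrow>
     R \<subseteq> relays \<and> distinct xs \<and> set xs = R \<and> lp_feasible s d C Imax xs A D"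

definition optimal_strategy ::
  "'v set \<Rightarrow> 'v \<Rightarrow> 'v \<Rightarrow> ('v \<Rightarrow> 'v \<Rightarrow> real) \<Rightarrow> real \<Rightarrow>
   'v set \<Rightarrow> 'v list \<Rightarrow> (nat \<Rightarrow> nat \<Rightarrow> real) \<Rightarrow> (nat \<Rightarrow> real) \<Rightarrow> bool"
where
  "optimal_strategy relays s d C Imax R xs A D \<longleftrightarrow>
     feasible_strategy relays s d C Imax R xs A D \<and>
     (\<forall>R' xs' A' D'. feasible_strategy relays s d C Imax R' xs' A' D' \<longrightarrow>
        total_delay xs D \<le> total_delay xs' D')"

text \<open>
  A relay that never transmits could be added to the set of an optimal strategy at no cost; hence
  the relays of a cooperating set are required to transmit for a non-zero duration.
\<close>

definition optimal_cooperating_set ::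
  "'v set \<Rightarrow> 'v \<Rightarrow> 'v \<Rightarrow> ('v \<Rightarrow> 'v \<Rightarrow> real) \<Rightarrow> real \<Rightarrow> 'v set \<Rightarrow> bool"
where
  "optimal_cooperating_set relays s d C Imax R \<longleftrightarrow>
     (\<exists>xs A D. optimal_strategy relays s d C Imax R xs A D \<and>
        (\<forall>i\<in>{1..length xs}. (\<Sum>j=0..length xs. A i j) > 0))"

end

theory Submission
  imports Defs
begin

text \<open>
  Let \<open>u 0, \<dots>, u N\<close> be the source, the relays in between from left to right, and the destination.
  In the greedy schedule each \<open>u k\<close> transmits, for a duration \<open>a k > 0\<close>, exactly until \<open>u (k + 1)\<close>
  has decoded, so that \<open>u k\<close> decodes at time \<open>T k\<close>.  In an arbitrary strategy no node at or beyond
  \<open>u k\<close> decodes before \<open>T k\<close>: up to then every transmitter is at most as far advanced as the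
  transmitter of the greedy schedule at the same moment, so that the nodes at or beyond \<open>u k\<close>
  collect at most what \<open>u k\<close> collects in the greedy schedule.  Continuous time is avoided by an
  Abel summation over the increments \<open>c l - c (l - 1)\<close> of the greedy rates.  For a strategy of delay
  \<open>T N\<close> all these inequalities are equalities, which forces the transmitters to be exactly
  \<open>u 0, \<dots>, u (N - 1)\<close>.
\<close>

section \<open>Greedy durations and Abel summation\<close>

text \<open>The condition that node \<open>Suc m\<close> collects exactly \<open>I\<close> from
  nodes \<open>0\<close> to \<open>m\<close>, solved for the duration of node
  \<open>m\<close>.\<close>

fun greedy :: "real \<Rightarrow> (nat \<Rightarrow> nat \<Rightarrow> real) \<Rightarrow> nat \<Rightarrow> real" where
  "greedy I c m = (I - (\<Sum>j<m. greedy I c j * c j (Suc m))) / c m (Suc m)"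

declare greedy.simps [simp del]

lemma greedy_sum:
  assumes "c m (Suc m) \<noteq> 0"
  shows "(\<Sum>j<Suc m. greedy I c j * c j (Suc m)) = I"
  using assms by (simp add: greedy.simps[of I c m])

text \<open>Difference sequence with the convention that \<open>g\<close> vanishes before index
  \<open>0\<close>, so that it telescopes to \<open>g\<close> itself.\<close>

definition incr :: "(nat \<Rightarrow> real) \<Rightarrow> nat \<Rightarrow> real" where
  "incr g l = (case l of 0 \<Rightarrow> g 0 | Suc k \<Rightarrow> g (Suc k) - g k)"

lemma sum_incr: "(\<Sum>l\<le>k. incr g l) = g k"
  by (induction k) (auto simp: incr_def)

text \<open>Each \<open>g l\<close> is the sum of its increments up to \<open>l\<close>; collecting
  terms by increment, the one at \<open>l\<close> is weighted by the tail of \<open>a\<close> from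
  \<open>l\<close> on.\<close>

lemma abel_sum_incr:
  "(\<Sum>l<n. a l * g l) = (\<Sum>l<n. incr g l * ((\<Sum>k<n. a k) - (\<Sum>k<l. a k)))"
proof (induction n)
  case (Suc n)
  have "(\<Sum>l<Suc n. incr g l * ((\<Sum>k<Suc n. a k) - (\<Sum>k<l. a k)))
      = (\<Sum>l<Suc n. incr g l * ((\<Sum>k<n. a k) - (\<Sum>k<l. a k)) + a n * incr g l)"
    by (intro sum.cong) (auto simp: algebra_simps)
  also have "\<dots> = (\<Sum>l<n. incr g l * ((\<Sum>k<n. a k) - (\<Sum>k<l. a k))) + a n * (\<Sum>l\<le>n. incr g l)"
    by (simp add: sum.distrib sum_distrib_left distrib_left lessThan_Suc_atMost[symmetric])
  also have "\<dots> = (\<Sum>l<Suc n. a l * g l)"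
    by (simp add: Suc sum_incr)
  finally show ?case by simp
qed simp

section \<open>The line network and its greedy schedule\<close>

text \<open>Normal form with the source on the left; the general case follows by sorting the relays
  in between and, if necessary, reflecting the line.\<close>

locale line_network =
  fixes relays :: "'v set" and s d :: 'v
    and C :: "'v \<Rightarrow> 'v \<Rightarrow> real" and Imax :: real
    and pos :: "'v \<Rightarrow> real" and f :: "real \<Rightarrow> real" and ys :: "'v list"
  assumes s_notin: "s \<notin> relays" and d_notin: "d \<notin> relays"
    and Imax_pos: "Imax > 0"
    and inj_pos: "inj_on pos ({s, d} \<union> relays)"
    and C_eq: "\<And>i j. i \<in> {s, d} \<union> relays \<Longrightarrow> j \<in> {s, d} \<union> relays \<Longrightarrow> i \<noteq> j \<Longrightarrow>
           C i j = f (dist (pos i) (pos j))"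
    and f_nonneg: "\<And>x. x > 0 \<Longrightarrow> f x \<ge> 0"
    and f_less: "\<And>x y. 0 < x \<Longrightarrow> x < y \<Longrightarrow> f y < f x"
    and s_less_d: "pos s < pos d"
    and set_ys: "set ys = {r \<in> relays. pos s < pos r \<and> pos r < pos d}"
    and sorted_ys: "sorted_wrt (\<lambda>x y. pos x < pos y) ys"
begin

definition N where "N = Suc (length ys)"

lemma N_pos [simp]: "0 < N" "N \<noteq> 0"
  by (simp_all add: N_def)

definition u where "u = node s d ys"

definition p where "p k = pos (u k)"

text \<open>A signed difference stands in place of the distance: this is the rate from
  \<open>u k\<close> to \<open>u m\<close> in the forward direction \<open>k < m\<close>.\<close>

definition c where "c k m = f (p m - p k)"

definition a where "a = greedy Imax c"

definition T where "T m = (\<Sum>l<m. a l)"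

lemma f_pos: "x > 0 \<Longrightarrow> f x > 0"
  using f_less[of x "x + 1"] f_nonneg[of "x + 1"] by simp

lemma f_le: "0 < x \<Longrightarrow> x \<le> y \<Longrightarrow> f y \<le> f x"
  using f_less[of x y] by (cases "x = y") auto

lemma u_0 [simp]: "u 0 = s" and u_N [simp]: "u N = d"
  by (auto simp: u_def node_def N_def nth_append)

lemma u_in_ys: "0 < k \<Longrightarrow> k < N \<Longrightarrow> u k \<in> set ys"
  by (cases k) (auto simp: u_def node_def N_def nth_append)

lemma in_ys_u:
  assumes "x \<in> set ys"
  obtains k where "0 < k" "k < N" "x = u k"
proof -
  obtain i where "i < length ys" "x = ys ! i"
    using assms by (auto simp: in_set_conv_nth)
  then show ?thesis
    by (intro that[of "Suc i"]) (auto simp: u_def node_def N_def nth_append)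
qed

lemma u_mem: "k \<le> N \<Longrightarrow> u k \<in> {s, d} \<union> relays"
  using u_in_ys[of k] set_ys by (cases "k = 0"; cases "k = N") auto

lemma p_less: "i < j \<Longrightarrow> j \<le> N \<Longrightarrow> p i < p j"
proof -
  have "sorted_wrt (\<lambda>x y. pos x < pos y) (s # ys @ [d])"
    using sorted_ys set_ys s_less_d by (auto simp: sorted_wrt_append)
  then show "i < j \<Longrightarrow> j \<le> N \<Longrightarrow> p i < p j"
    unfolding p_def u_def node_def N_def
    by (intro sorted_wrt_nth_less[where P = "\<lambda>x y. pos x < pos y"]) auto
qed

lemma p_le_iff: "i \<le> N \<Longrightarrow> j \<le> N \<Longrightarrow> p i \<le> p j \<longleftrightarrow> i \<le> j"
  using p_less[of i j] p_less[of j i] by (cases i j rule: linorder_cases) auto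

lemma c_pos: "k < m \<Longrightarrow> m \<le> N \<Longrightarrow> c k m > 0"
  unfolding c_def using p_less[of k m] by (intro f_pos) auto

lemma c_less: "k < l \<Longrightarrow> l < m \<Longrightarrow> m \<le> N \<Longrightarrow> c k m < c l m"
  unfolding c_def using p_less[of k l] p_less[of l m] by (intro f_less) auto

lemma c_less_target: "k < m \<Longrightarrow> m < m' \<Longrightarrow> m' \<le> N \<Longrightarrow> c k m' < c k m"
  unfolding c_def using p_less[of k m] p_less[of m m'] by (intro f_less) auto

lemma C_u: "k < m \<Longrightarrow> m \<le> N \<Longrightarrow> C (u k) (u m) = c k m"
  using p_less[of k m] C_eq[OF u_mem[of k] u_mem[of m]]
  by (cases "u k = u m") (auto simp: c_def p_def dist_real_def)

text \<open>A transmitter closer to \<open>u m\<close> has the higher rate. Positivity lets the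
  increments serve as weights that turn bounds on transmission times into bounds on collected
  information.\<close>

lemma incr_c_pos: "l < m \<Longrightarrow> m \<le> N \<Longrightarrow> incr (\<lambda>k. c k m) l > 0"
  using c_pos[of 0 m] c_less[of "l - 1" l m] by (cases l) (auto simp: incr_def)

lemma a_sum: "0 < m \<Longrightarrow> m \<le> N \<Longrightarrow> (\<Sum>j<m. a j * c j m) = Imax"
  using greedy_sum[of c "m - 1" Imax] c_pos[of "m - 1" m] unfolding a_def by (cases m) auto

text \<open>The transmissions that give \<open>u m\<close> exactly \<open>Imax\<close> give the more
  distant \<open>u (Suc m)\<close> strictly less, so a positive amount is left for
  \<open>u m\<close> to send.\<close>

lemma a_pos: "m < N \<Longrightarrow> a m > 0"
proof (induction m rule: less_induct)
  case (less m)
  have "(\<Sum>j<m. a j * c j (Suc m)) < Imax"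
  proof (cases "m = 0")
    case False
    have "(\<Sum>j<m. a j * c j (Suc m)) < (\<Sum>j<m. a j * c j m)"
      using False less by (intro sum_strict_mono mult_strict_left_mono c_less_target) auto
    then show ?thesis using a_sum[of m] False less.prems by simp
  qed (use Imax_pos in simp)
  moreover have "(\<Sum>j<m. a j * c j (Suc m)) + a m * c m (Suc m) = Imax"
    using a_sum[of "Suc m"] less.prems by simp
  ultimately have "a m * c m (Suc m) > 0" by linarith
  then show ?case
    using c_pos[of m "Suc m"] less.prems by (simp add: zero_less_mult_iff)
qed

text \<open>Abel form of \<open>a_sum\<close>: \<open>T m - T l\<close> is the time for which the
  greedy schedule transmits from \<open>u l\<close> or further along before \<open>u m\<close>
  decodes.\<close>

lemma T_incr_sum: "0 < m \<Longrightarrow> m \<le> N \<Longrightarrow> (\<Sum>l<m. incr (\<lambda>k. c k m) l * (T m - T l)) = Imax"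
  unfolding T_def using abel_sum_incr[of a "\<lambda>k. c k m" m] a_sum[of m] by simp

lemma T_mono: "k \<le> m \<Longrightarrow> m \<le> N \<Longrightarrow> T k \<le> T m"
  unfolding T_def using a_pos by (intro sum_mono2) (auto intro: less_imp_le)

section \<open>Staircase bounds on the capacities\<close>

text \<open>The disjunct \<open>l = 0\<close> covers the nodes behind the source; the rate \<open>c 0 m\<close> bounds theirs as well.\<close>

definition reaches :: "nat \<Rightarrow> 'v \<Rightarrow> bool" where
  "reaches l x \<longleftrightarrow> l = 0 \<or> p l \<le> pos x"

text \<open>Nodes behind the source get index \<open>0\<close> as well, in agreement with
  \<open>reaches\<close>.\<close>

lemma node_cases:
  assumes "x \<in> {s, d} \<union> relays" "pos x < pos d"
  obtains k where "k < N" "x = u k \<or> k = 0 \<and> pos x < p 0"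
proof (cases "pos x < pos s \<or> x = s")
  case True
  then show ?thesis by (intro that[of 0]) (auto simp: N_def p_def)
next
  case False
  then have "pos x \<noteq> pos s" using inj_onD[OF inj_pos, of x s] assms by auto
  then have "x \<in> set ys" using False assms set_ys by auto
  then show ?thesis using that in_ys_u by metis
qed

text \<open>The levels that \<open>x\<close> reaches are exactly those up to \<open>k\<close>, so
  the increments telescope. Written this way, a rate is a combination of indicators, and its sum
  over transmissions becomes a combination of airtimes.\<close>

lemma staircase:
  assumes x: "x = u k \<or> k = 0 \<and> pos x < p 0" and km: "k < m" "m \<le> N"
  shows "(\<Sum>l<m. if reaches l x then incr (\<lambda>k. c k m) l else 0) = c k m"
proof -
  have "reaches l x \<longleftrightarrow> l \<le> k" if "l < m" for l
    using x p_le_iff[of l k] p_less[of 0 l] that km by (auto simp: reaches_def p_def)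
  then have "(\<Sum>l<m. if reaches l x then incr (\<lambda>k. c k m) l else 0)
      = (\<Sum>l<m. if l \<le> k then incr (\<lambda>k. c k m) l else 0)"
    by (intro sum.cong) auto
  also have "\<dots> = (\<Sum>l\<in>{..<m} \<inter> {l. l \<le> k}. incr (\<lambda>k. c k m) l)"
    by (simp add: sum.inter_restrict)
  also have "{..<m} \<inter> {l. l \<le> k} = {..k}" using km by auto
  finally show ?thesis by (simp add: sum_incr)
qed

text \<open>Moving \<open>x\<close> forward to \<open>u k\<close> and \<open>y\<close> back to
  \<open>u m\<close> only shortens the distance.\<close>

lemma C_le_staircase:
  assumes x: "x \<in> {s, d} \<union> relays" "pos x < p m" and y: "y \<in> {s, d} \<union> relays" "p m \<le> pos y"
    and m: "0 < m" "m \<le> N"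
  shows "C x y \<le> (\<Sum>l<m. if reaches l x then incr (\<lambda>k. c k m) l else 0)"
proof -
  have "p m \<le> pos d" using p_le_iff[of m N] m by (simp add: p_def)
  then obtain k where k: "k < N" "x = u k \<or> k = 0 \<and> pos x < p 0"
    using node_cases x by (metis less_le_trans)
  have m0: "k < m"
  proof (rule ccontr)
    assume "\<not> k < m"
    then have "p m \<le> p k" using p_le_iff[of m k] k m by auto
    then show False using k x m \<open>\<not> k < m\<close> by (auto simp: p_def)
  qed
  have "pos x \<le> p k" using k by (auto simp: p_def)
  have "C x y = f (pos y - pos x)"
    using C_eq[OF x(1) y(1)] x y by (cases "x = y") (auto simp: dist_real_def)
  also have "\<dots> \<le> c k m"
    unfolding c_def using \<open>pos x \<le> p k\<close> y p_less[OF m0 m(2)] by (intro f_le) auto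
  also have "\<dots> = (\<Sum>l<m. if reaches l x then incr (\<lambda>k. c k m) l else 0)"
    using staircase[OF k(2) m0 m(2)] by simp
  finally show ?thesis .
qed

text \<open>Such an \<open>x\<close> lies behind the source, hence strictly further from
  \<open>d\<close> than \<open>u 0\<close>, whose rate the staircase assigns to it.\<close>

lemma C_less_staircase:
  assumes x: "x \<in> {s, d} \<union> relays" "pos x < pos d" and nu: "\<And>k. k < N \<Longrightarrow> x \<noteq> u k"
  shows "C x d < (\<Sum>l<N. if reaches l x then incr (\<lambda>k. c k N) l else 0)"
proof -
  obtain k where "k < N" "x = u k \<or> k = 0 \<and> pos x < p 0"
    using node_cases x by metis
  then have px: "pos x < p 0" using nu by auto
  have "C x d = f (pos d - pos x)"
    using C_eq[OF x(1), of d] x by (cases "x = d") (auto simp: dist_real_def)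
  also have "\<dots> < c 0 N"
    unfolding c_def using px s_less_d by (intro f_less) (auto simp: p_def)
  also have "\<dots> = (\<Sum>l<N. if reaches l x then incr (\<lambda>k. c k N) l else 0)"
    using staircase[of x 0 N] px by (simp add: N_def)
  finally show ?thesis .
qed

end

section \<open>Decoding times in an arbitrary strategy\<close>

locale line_strategy = line_network +
  fixes K :: nat and v :: "nat \<Rightarrow> 'a" and A :: "nat \<Rightarrow> nat \<Rightarrow> real" and D :: "nat \<Rightarrow> real"
  assumes v_0: "v 0 = s" and v_last: "v (Suc K) = d"
    and v_relays: "\<And>i. 0 < i \<Longrightarrow> i \<le> K \<Longrightarrow> v i \<in> relays"
    and info: "\<And>m. 0 < m \<Longrightarrow> m \<le> Suc K \<Longrightarrow> Imax \<le> (\<Sum>j<m. \<Sum>i\<le>j. A i j * C (v i) (v m))"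
    and dur: "\<And>j. j \<le> K \<Longrightarrow> (\<Sum>i\<le>j. A i j) \<le> D j"
    and A_nonneg: "\<And>i j. i \<le> j \<Longrightarrow> j \<le> K \<Longrightarrow> A i j \<ge> 0"
begin

text \<open>The start of stage \<open>m\<close>, which is the decoding time of
  \<open>v m\<close>.\<close>

definition S where "S m = (\<Sum>j<m. D j)"

text \<open>Counterpart, for an arbitrary strategy, of the differences of \<open>T\<close> in
  \<open>T_incr_sum\<close>; here \<open>m\<close> counts stages.\<close>

definition airtime where
  "airtime l m = (\<Sum>j<m. \<Sum>i\<le>j. if reaches l (v i) then A i j else 0)"

lemma v_mem: "i \<le> Suc K \<Longrightarrow> v i \<in> {s, d} \<union> relays"
  using v_relays[of i] v_0 v_last by (cases "i = 0"; cases "i = Suc K") auto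

lemma D_nonneg: "j \<le> K \<Longrightarrow> D j \<ge> 0"
  using dur[of j] sum_nonneg[of "{..j}" "\<lambda>i. A i j"] A_nonneg[of _ j] by fastforce

lemma S_mono: "i \<le> j \<Longrightarrow> j \<le> Suc K \<Longrightarrow> S i \<le> S j"
  unfolding S_def using D_nonneg by (intro sum_mono2) auto

text \<open>Until a node reaching level \<open>l\<close> has decoded, a stage adds nothing.
  Afterwards the time is at least \<open>T l\<close>, and by orthogonality stage \<open>j\<close>
  adds at most \<open>D j\<close>.\<close>

lemma airtime_le:
  assumes "\<And>i. i < m \<Longrightarrow> reaches l (v i) \<Longrightarrow> T l \<le> S i" "m \<le> Suc K"
  shows "airtime l m \<le> max 0 (S m - T l)"
  using assms
proof (induction m)
  case (Suc m)
  have IH: "airtime l m \<le> max 0 (S m - T l)" using Suc by auto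
  have S_Suc: "S (Suc m) = S m + D m" by (simp add: S_def)
  have D0: "0 \<le> D m" using D_nonneg Suc.prems by auto
  have E: "airtime l (Suc m) = airtime l m + (\<Sum>i\<le>m. if reaches l (v i) then A i m else 0)"
    by (simp add: airtime_def)
  show ?case
  proof (cases "\<exists>i\<le>m. reaches l (v i)")
    case True
    then obtain i where "i \<le> m" "reaches l (v i)" by auto
    then have "T l \<le> S i" using Suc.prems(1)[of i] by simp
    also have "S i \<le> S m" using S_mono[of i m] \<open>i \<le> m\<close> Suc.prems(2) by simp
    finally have "T l \<le> S m" .
    moreover have "(\<Sum>i\<le>m. if reaches l (v i) then A i m else 0) \<le> (\<Sum>i\<le>m. A i m)"
      using A_nonneg Suc.prems by (intro sum_mono) auto
    moreover have "\<dots> \<le> D m" using dur Suc.prems by auto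
    ultimately show ?thesis using IH unfolding E S_Suc by linarith
  next
    case False
    then have "(\<Sum>i\<le>m. if reaches l (v i) then A i m else 0) = 0" by (intro sum.neutral) auto
    then show ?thesis using IH D0 unfolding E S_Suc by linarith
  qed
qed (simp add: airtime_def)

lemma sum_staircase:
  "(\<Sum>j<i. \<Sum>i'\<le>j. A i' j * (\<Sum>l<m. if reaches l (v i') then g l else 0))
    = (\<Sum>l<m. g l * airtime l i)"
proof -
  have "(\<Sum>j<i. \<Sum>i'\<le>j. A i' j * (\<Sum>l<m. if reaches l (v i') then g l else 0))
      = (\<Sum>j<i. \<Sum>i'\<le>j. \<Sum>l<m. g l * (if reaches l (v i') then A i' j else 0))"
    by (simp add: sum_distrib_left if_distrib mult.commute cong: if_cong)
  also have "\<dots> = (\<Sum>j<i. \<Sum>l<m. \<Sum>i'\<le>j. g l * (if reaches l (v i') then A i' j else 0))"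
    by (intro sum.cong refl sum.swap)
  also have "\<dots> = (\<Sum>l<m. \<Sum>j<i. \<Sum>i'\<le>j. g l * (if reaches l (v i') then A i' j else 0))"
    by (rule sum.swap)
  finally show ?thesis by (simp add: airtime_def sum_distrib_left)
qed

text \<open>All that \<open>v i\<close> hears comes from behind \<open>u m\<close>, so the staircase
  bound applies to each transmission. Assuming silence rather than absence of the nodes at or beyond
  \<open>u m\<close> makes this usable also for the destination in the tight case.\<close>

lemma info_le_airtime:
  assumes i: "0 < i" "i \<le> Suc K" and m: "0 < m" "m \<le> N" "p m \<le> pos (v i)"
    and behind: "\<And>i' j. i' \<le> j \<Longrightarrow> j < i \<Longrightarrow> p m \<le> pos (v i') \<Longrightarrow> A i' j = 0"
  shows "Imax \<le> (\<Sum>l<m. incr (\<lambda>k. c k m) l * airtime l i)"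
proof -
  have "Imax \<le> (\<Sum>j<i. \<Sum>i'\<le>j. A i' j * C (v i') (v i))" by (rule info[OF i])
  also have "\<dots> \<le> (\<Sum>j<i. \<Sum>i'\<le>j. A i' j *
      (\<Sum>l<m. if reaches l (v i') then incr (\<lambda>k. c k m) l else 0))"
  proof (intro sum_mono)
    fix j i' assume *: "j \<in> {..<i}" "i' \<in> {..j}"
    show "A i' j * C (v i') (v i)
        \<le> A i' j * (\<Sum>l<m. if reaches l (v i') then incr (\<lambda>k. c k m) l else 0)"
    proof (cases "p m \<le> pos (v i')")
      case True
      then show ?thesis using behind * by auto
    next
      case False
      then show ?thesis
        using * i m by (intro mult_left_mono C_le_staircase v_mem A_nonneg) auto
    qed
  qed
  finally show ?thesis by (simp only: sum_staircase)
qed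

text \<open>Strong induction on \<open>i\<close> with \<open>m\<close> arbitrary: the transmitters
  heard by \<open>v i\<close> precede it in the decoding order, so the hypothesis bounds their
  airtime at every level \<open>l < m\<close>. If \<open>S i < T m\<close>, weighting these bounds
  by the increments leaves less than the \<open>Imax\<close> of \<open>T_incr_sum\<close>.\<close>

lemma decode_time:
  "i \<le> Suc K \<Longrightarrow> m \<le> N \<Longrightarrow> reaches m (v i) \<Longrightarrow> T m \<le> S i"
proof (induction i arbitrary: m rule: less_induct)
  case (less i)
  have S0: "0 \<le> S i" using S_mono[of 0 i] less.prems by (simp add: S_def)
  show ?case
  proof (cases "m = 0")
    case True
    then show ?thesis using S0 by (simp add: T_def)
  next
    case False
    then have pm: "p m \<le> pos (v i)" using less.prems by (auto simp: reaches_def)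
    have "i \<noteq> 0"
    proof
      assume "i = 0"
      then show False using pm p_less[of 0 m] False less.prems by (simp add: v_0 p_def)
    qed
    \<comment> \<open>Only the first node at or beyond \<open>u m\<close> needs the counting
      argument; a later one inherits the bound.\<close>
    show ?thesis
    proof (cases "\<exists>i'<i. p m \<le> pos (v i')")
      case True
      then obtain i' where "i' < i" "p m \<le> pos (v i')" by auto
      then show ?thesis
        using less.IH[of i' m] S_mono[of i' i] less.prems by (auto simp: reaches_def)
    next
      case behind: False
      show ?thesis
      proof (rule ccontr)
        assume "\<not> T m \<le> S i"
        then have SlT: "S i < T m" by simp
        have "Imax \<le> (\<Sum>l<m. incr (\<lambda>k. c k m) l * airtime l i)"
          using \<open>i \<noteq> 0\<close> False less.prems pm behind by (intro info_le_airtime) force+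
        also have "\<dots> < (\<Sum>l<m. incr (\<lambda>k. c k m) l * (T m - T l))"
        proof (rule sum_strict_mono_ex1)
          have A: "airtime l i \<le> max 0 (S i - T l)" if "l < m" for l
            using less.IH[of _ l] less.prems that by (intro airtime_le) auto
          show "\<forall>l\<in>{..<m}. incr (\<lambda>k. c k m) l * airtime l i \<le> incr (\<lambda>k. c k m) l * (T m - T l)"
          proof
            fix l assume l: "l \<in> {..<m}"
            have "airtime l i \<le> T m - T l"
              using A[of l] l T_mono[of l m] SlT less.prems by auto
            then show "incr (\<lambda>k. c k m) l * airtime l i \<le> incr (\<lambda>k. c k m) l * (T m - T l)"
              using incr_c_pos[of l m] l less.prems by (intro mult_left_mono) auto
          qed
          \<comment> \<open>Strictness comes from level \<open>0\<close>: since
            \<open>T 0 = 0\<close> and \<open>0 \<le> S i\<close>, the maximum is \<open>S i\<close>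
            itself, which is below \<open>T m\<close>.\<close>
          have "airtime 0 i < T m - T 0"
            using A[of 0] False SlT S0 by (simp add: T_def)
          then show "\<exists>l\<in>{..<m}. incr (\<lambda>k. c k m) l * airtime l i < incr (\<lambda>k. c k m) l * (T m - T l)"
            using incr_c_pos[of 0 m] False less.prems
            by (intro bexI[of _ 0] mult_strict_left_mono) auto
        qed simp
        also have "\<dots> = Imax" using T_incr_sum False less.prems by simp
        finally show False by simp
      qed
    qed
  qed
qed

lemma delay_ge: "T N \<le> S (Suc K)"
  by (rule decode_time) (auto simp: reaches_def v_last p_def)

section \<open>Strategies that attain the greedy delay\<close>

context
  assumes tight: "S (Suc K) = T N"
begin

text \<open>Such a node decodes no earlier than \<open>T N\<close>, the end of the whole strategy,
  so every stage left to it has length zero.\<close>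

lemma beyond_silent:
  assumes "i \<le> j" "j \<le> K" "pos d \<le> pos (v i)"
  shows "A i j = 0"
proof -
  have "T N \<le> S i" using assms by (intro decode_time) (auto simp: reaches_def p_def)
  also have "S i \<le> S j" using S_mono assms by simp
  also have "S j + D j \<le> S (Suc K)" using S_mono[of "Suc j" "Suc K"] assms by (simp add: S_def)
  finally have "D j \<le> 0" using tight by simp
  moreover have "A i j \<le> (\<Sum>i\<le>j. A i j)"
    using A_nonneg assms by (intro member_le_sum) auto
  ultimately show ?thesis using dur[of j] A_nonneg[of i j] assms by simp
qed

lemma airtime_le_tight: "l < N \<Longrightarrow> airtime l (Suc K) \<le> T N - T l"
  using airtime_le[of "Suc K" l] decode_time[of _ l] T_mono[of l N] tight by auto

text \<open>A deficit at a single level has positive weight and would leave \<open>d\<close> with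
  less than \<open>Imax\<close>.\<close>

lemma airtime_tight:
  assumes "l < N"
  shows "airtime l (Suc K) = T N - T l"
proof (rule ccontr)
  assume "airtime l (Suc K) \<noteq> T N - T l"
  then have less: "airtime l (Suc K) < T N - T l" using airtime_le_tight[OF assms] by simp
  have "Imax \<le> (\<Sum>l<N. incr (\<lambda>k. c k N) l * airtime l (Suc K))"
    using beyond_silent by (intro info_le_airtime) (auto simp: v_last p_def)
  also have "\<dots> < (\<Sum>l<N. incr (\<lambda>k. c k N) l * (T N - T l))"
  proof (rule sum_strict_mono_ex1)
    show "\<forall>l\<in>{..<N}. incr (\<lambda>k. c k N) l * airtime l (Suc K) \<le> incr (\<lambda>k. c k N) l * (T N - T l)"
      using airtime_le_tight incr_c_pos[of _ N] by (auto intro!: mult_left_mono less_imp_le)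
    show "\<exists>l\<in>{..<N}. incr (\<lambda>k. c k N) l * airtime l (Suc K) < incr (\<lambda>k. c k N) l * (T N - T l)"
      using less incr_c_pos[of l N] assms by (intro bexI[of _ l] mult_strict_left_mono) auto
  qed simp
  also have "\<dots> = Imax" using T_incr_sum[of N] by simp
  finally show False by simp
qed

text \<open>With the exact airtimes, the staircase bounds on what \<open>d\<close> collects add up
  to exactly \<open>Imax\<close>, so none can be strict for a positive duration. They are strict
  behind the source, and nodes at or beyond \<open>d\<close> are silent.\<close>

lemma transmitter:
  assumes ij: "i \<le> j" "j \<le> K" "A i j > 0"
  shows "\<exists>k<N. v i = u k"
proof (rule ccontr)
  assume nu: "\<not> (\<exists>k<N. v i = u k)"
  let ?h = "\<lambda>x. \<Sum>l<N. if reaches l x then incr (\<lambda>k. c k N) l else 0"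
  have le: "A i' j' * C (v i') d \<le> A i' j' * ?h (v i')" if "i' \<le> j'" "j' \<le> K" for i' j'
  proof (cases "pos d \<le> pos (v i')")
    case False
    then show ?thesis
      using that by (intro mult_left_mono C_le_staircase v_mem A_nonneg) (auto simp: p_def)
  qed (use beyond_silent that in auto)
  have "pos (v i) < pos d" using beyond_silent[of i j] ij by force
  then have less: "A i j * C (v i) d < A i j * ?h (v i)"
    using nu ij by (intro mult_strict_left_mono C_less_staircase v_mem) auto
  have "Imax \<le> (\<Sum>j<Suc K. \<Sum>i\<le>j. A i j * C (v i) d)"
    using info[of "Suc K"] by (simp add: v_last)
  also have "\<dots> < (\<Sum>j<Suc K. \<Sum>i\<le>j. A i j * ?h (v i))"
  proof (rule sum_strict_mono_ex1)
    show "\<forall>j\<in>{..<Suc K}. (\<Sum>i\<le>j. A i j * C (v i) d) \<le> (\<Sum>i\<le>j. A i j * ?h (v i))"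
      using le by (intro ballI sum_mono) auto
    have "(\<Sum>i\<le>j. A i j * C (v i) d) < (\<Sum>i\<le>j. A i j * ?h (v i))"
      using le less ij by (intro sum_strict_mono_ex1 bexI[of _ i]) auto
    then show "\<exists>j\<in>{..<Suc K}. (\<Sum>i\<le>j. A i j * C (v i) d) < (\<Sum>i\<le>j. A i j * ?h (v i))"
      using ij by auto
  qed simp
  also have "\<dots> = (\<Sum>l<N. incr (\<lambda>k. c k N) l * airtime l (Suc K))"
    by (rule sum_staircase)
  also have "\<dots> = (\<Sum>l<N. incr (\<lambda>k. c k N) l * (T N - T l))"
    by (intro sum.cong) (auto simp: airtime_tight)
  also have "\<dots> = Imax" using T_incr_sum[of N] by simp
  finally show False by simp
qed

text \<open>The airtimes at levels \<open>k\<close> and \<open>Suc k\<close> differ by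
  \<open>a k > 0\<close>, so some transmitter reaches the former but not the latter; being some
  \<open>u k'\<close>, it must be \<open>u k\<close>.\<close>

lemma all_transmit:
  assumes k: "k < N"
  obtains i where "i \<le> K" "v i = u k"
proof -
  have "\<exists>i j. i \<le> j \<and> j \<le> K \<and> A i j > 0 \<and> reaches k (v i) \<and> \<not> reaches (Suc k) (v i)"
  proof (rule ccontr)
    assume none: "\<not> ?thesis"
    have "airtime k (Suc K) \<le> airtime (Suc k) (Suc K)"
      unfolding airtime_def
    proof (intro sum_mono)
      fix j i assume *: "j \<in> {..<Suc K}" "i \<in> {..j}"
      show "(if reaches k (v i) then A i j else 0) \<le> (if reaches (Suc k) (v i) then A i j else 0)"
        using none A_nonneg[of i j] * by (auto simp: less_le)
    qed
    \<comment> \<open>Level \<open>N\<close> is outside the range of \<open>airtime_tight\<close>;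
      there the airtime is zero by \<open>beyond_silent\<close>.\<close>
    moreover have "airtime (Suc k) (Suc K) = T N - T (Suc k)"
    proof (cases "Suc k = N")
      case True
      have "airtime N (Suc K) = 0"
        unfolding airtime_def using beyond_silent
        by (intro sum.neutral ballI) (auto simp: reaches_def p_def)
      then show ?thesis using True by simp
    qed (use k airtime_tight in auto)
    ultimately show False using airtime_tight[OF k] a_pos[OF k] by (simp add: T_def)
  qed
  then obtain i j where ij: "i \<le> j" "j \<le> K" "A i j > 0" "reaches k (v i)" "\<not> reaches (Suc k) (v i)"
    by blast
  then obtain k' where k': "k' < N" "v i = u k'" using transmitter by blast
  have "k \<le> k'" "\<not> Suc k \<le> k'"
    using ij k k' p_le_iff[of k k'] p_le_iff[of "Suc k" k'] by (auto simp: reaches_def p_def)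
  then have "k' = k" by simp
  then show ?thesis using that[of i] k' ij by simp
qed

lemma transmitting_relays:
  assumes "\<And>i. 0 < i \<Longrightarrow> i \<le> K \<Longrightarrow> \<exists>j\<ge>i. j \<le> K \<and> A i j > 0"
  shows "v ` {1..K} = set ys"
proof (intro equalityI subsetI)
  fix x assume "x \<in> v ` {1..K}"
  then obtain i where i: "0 < i" "i \<le> K" "x = v i" by (auto simp: Suc_le_eq)
  then obtain j where "i \<le> j" "j \<le> K" "A i j > 0" using assms by blast
  then obtain k where k: "k < N" "x = u k" using i transmitter by blast
  have "x \<noteq> s" using i v_relays s_notin by auto
  then have "k \<noteq> 0" using k by (cases k) auto
  then show "x \<in> set ys" using k u_in_ys by simp
next
  fix x assume x: "x \<in> set ys"
  then obtain k where k: "k < N" "x = u k" by (rule in_ys_u)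
  obtain i where i: "i \<le> K" "v i = u k" using k(1) by (rule all_transmit)
  have "i \<noteq> 0" using i k x set_ys v_0 s_notin by (cases i) auto
  then show "x \<in> v ` {1..K}" using i k by (intro image_eqI[of _ _ i]) auto
qed

end

end

section \<open>The linear program and optimality of the greedy schedule\<close>

text \<open>Interchanging the sums regroups the square by stage, and the entries with
  \<open>i > j\<close> vanish.\<close>

lemma lp_sum_triangle:
  fixes A :: "nat \<Rightarrow> nat \<Rightarrow> real"
  assumes "\<And>i j. i < m \<Longrightarrow> j < m \<Longrightarrow> i > j \<Longrightarrow> A i j = 0" and "0 < m"
  shows "(\<Sum>i=0..m-1. \<Sum>j=0..m-1. A i j * w i) = (\<Sum>j<m. \<Sum>i\<le>j. A i j * w i)"
proof -
  have "{0..m-1} = {..<m}" using assms(2) by auto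
  then have "(\<Sum>i=0..m-1. \<Sum>j=0..m-1. A i j * w i) = (\<Sum>i<m. \<Sum>j<m. A i j * w i)"
    by (simp only:)
  also have "\<dots> = (\<Sum>j<m. \<Sum>i<m. A i j * w i)"
    by (rule sum.swap)
  also have "\<dots> = (\<Sum>j<m. \<Sum>i\<le>j. A i j * w i)"
    using assms by (intro sum.cong[OF refl] sum.mono_neutral_right) auto
  finally show ?thesis .
qed

lemma total_delay_eq: "total_delay xs D = (\<Sum>j<Suc (length xs). D j)"
  by (simp add: total_delay_def atLeast0AtMost lessThan_Suc_atMost)

lemma image_node: "node s d xs ` {1..length xs} = set xs"
proof -
  have "node s d xs ` {1..length xs} = node s d xs ` Suc ` {..<length xs}"
    by (simp add: image_Suc_lessThan)
  also have "\<dots> = (!) xs ` {..<length xs}"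
    unfolding image_image by (intro image_cong) (auto simp: node_def nth_append)
  finally show ?thesis by (simp add: set_conv_nth image_def Bex_def conj_commute)
qed

context line_network
begin

lemma feasible_line_strategy:
  assumes "feasible_strategy relays s d C Imax R xs A D"
  shows "line_strategy relays s d C Imax pos f ys (length xs) (node s d xs) A D"
proof -
  have lp: "lp_feasible s d C Imax xs A D" and R: "set xs \<subseteq> relays"
    using assms by (auto simp: feasible_strategy_def)
  show ?thesis
  proof unfold_locales
    show "node s d xs i \<in> relays" if "0 < i" "i \<le> length xs" for i
      using that R image_node[of s d xs] by fastforce
    show "Imax \<le> (\<Sum>j<m. \<Sum>i\<le>j. A i j * C (node s d xs i) (node s d xs m))"
      if m: "0 < m" "m \<le> Suc (length xs)" for m
    proof -
      have "m \<in> {1..length xs + 1}" using m by auto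
      then have "Imax \<le> (\<Sum>i=0..m-1. \<Sum>j=0..m-1. A i j * C (node s d xs i) (node s d xs m))"
        using lp unfolding lp_feasible_def by blast
      also have "\<dots> = (\<Sum>j<m. \<Sum>i\<le>j. A i j * C (node s d xs i) (node s d xs m))"
        using lp m by (intro lp_sum_triangle) (auto simp: lp_feasible_def)
      finally show ?thesis .
    qed
    show "(\<Sum>i\<le>j. A i j) \<le> D j" if "j \<le> length xs" for j
      using lp that by (simp add: lp_feasible_def atLeast0AtMost)
    show "A i j \<ge> 0" if "i \<le> j" "j \<le> length xs" for i j
      using lp that by (simp add: lp_feasible_def)
  qed (auto simp: node_def nth_append)
qed

text \<open>Stage \<open>i\<close> belongs entirely to \<open>u i\<close>, the node that has just
  decoded, so \<open>a\<close> also gives the stage durations.\<close>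

definition A_greedy where "A_greedy i j = (if i = j then a i else 0)"

lemma feasible_greedy: "feasible_strategy relays s d C Imax (set ys) ys A_greedy a"
proof -
  have "Imax \<le> (\<Sum>i=0..m-1. \<Sum>j=0..m-1. A_greedy i j * C (u i) (u m))"
    if m: "m \<in> {1..length ys + 1}" for m
  proof -
    have "(\<Sum>i=0..m-1. \<Sum>j=0..m-1. A_greedy i j * C (u i) (u m))
        = (\<Sum>j<m. \<Sum>i\<le>j. A_greedy i j * C (u i) (u m))"
      using m by (intro lp_sum_triangle) (auto simp: A_greedy_def)
    also have "\<dots> = (\<Sum>j<m. a j * c j m)"
      using m by (intro sum.cong refl)
        (auto simp: A_greedy_def if_distrib[of "\<lambda>x. x * _"] C_u N_def cong: if_cong)
    also have "\<dots> = Imax" using m a_sum by (simp add: N_def)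
    finally show ?thesis by simp
  qed
  moreover have "distinct ys"
    using sorted_ys by (auto simp: distinct_conv_nth sorted_wrt_iff_nth_less neq_iff)
      (metis less_irrefl)+
  ultimately show ?thesis
    using set_ys a_pos by (auto simp: feasible_strategy_def lp_feasible_def u_def[symmetric]
        A_greedy_def N_def less_imp_le)
qed

lemma optimal_greedy: "optimal_strategy relays s d C Imax (set ys) ys A_greedy a"
  unfolding optimal_strategy_def
proof (intro conjI allI impI feasible_greedy)
  fix R' xs' A' D' assume "feasible_strategy relays s d C Imax R' xs' A' D'"
  then interpret line_strategy relays s d C Imax pos f ys "length xs'" "node s d xs'" A' D'
    by (rule feasible_line_strategy)
  show "total_delay ys a \<le> total_delay xs' D'"
    using delay_ge by (simp add: total_delay_eq S_def T_def N_def del: sum.lessThan_Suc)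
qed

text \<open>An optimal strategy cannot exceed the greedy delay, so it is tight and
  \<open>transmitting_relays\<close> applies. Conversely, the greedy schedule is optimal and its
  relays transmit for positive durations.\<close>

lemma optimal_cooperating_set_iff:
  "optimal_cooperating_set relays s d C Imax R \<longleftrightarrow> R = set ys"
proof
  assume "optimal_cooperating_set relays s d C Imax R"
  then obtain xs A D where opt: "optimal_strategy relays s d C Imax R xs A D"
    and pos: "\<And>i. i \<in> {1..length xs} \<Longrightarrow> (\<Sum>j=0..length xs. A i j) > 0"
    by (auto simp: optimal_cooperating_set_def)
  have feas: "feasible_strategy relays s d C Imax R xs A D"
    using opt by (simp add: optimal_strategy_def)
  then interpret line_strategy relays s d C Imax pos f ys "length xs" "node s d xs" A D
    by (rule feasible_line_strategy)
  have "total_delay xs D \<le> total_delay ys a"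
    using opt feasible_greedy unfolding optimal_strategy_def by blast
  then have tight: "S (Suc (length xs)) = T N"
    using delay_ge by (simp add: total_delay_eq S_def T_def N_def del: sum.lessThan_Suc)
  have "node s d xs ` {1..length xs} = set ys"
  proof (rule transmitting_relays[OF tight])
    fix i assume i: "0 < i" "i \<le> length xs"
    show "\<exists>j\<ge>i. j \<le> length xs \<and> A i j > 0"
    proof (rule ccontr)
      assume none: "\<not> ?thesis"
      \<comment> \<open>The positive total of node \<open>i\<close> includes stages before its
        decoding; these contribute nothing, so a stage \<open>j \<ge> i\<close> must be
        positive.\<close>
      have "A i j = 0" if "j < i" "j \<le> length xs" for j
        using feas i that by (simp add: feasible_strategy_def lp_feasible_def)
      then have "(\<Sum>j=0..length xs. A i j) \<le> 0"
        using none by (intro sum_nonpos) (metis atLeastAtMost_iff not_less order_refl)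
      then show False using pos[of i] i by simp
    qed
  qed
  then show "R = set ys"
    using feas unfolding image_node by (simp add: feasible_strategy_def)
next
  assume "R = set ys"
  moreover have "(\<Sum>j=0..length ys. A_greedy i j) > 0" if "i \<in> {1..length ys}" for i
    using that a_pos[of i] by (simp add: A_greedy_def N_def)
  ultimately show "optimal_cooperating_set relays s d C Imax R"
    using optimal_greedy unfolding optimal_cooperating_set_def by blast
qed

end

section \<open>Sorting the relays and orienting the line\<close>

lemma ex_sorted_key:
  fixes g :: "'v \<Rightarrow> real"
  assumes "finite B" "inj_on g B"
  obtains ys where "set ys = B" "sorted_wrt (\<lambda>x y. g x < g y) ys"
proof -
  obtain zs where zs: "set zs = B" "distinct zs" using finite_distinct_list assms(1) by blast
  have "distinct (map g (sort_key g zs))" using zs assms by (simp add: distinct_map)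
  \<comment> \<open>Injectivity of \<open>g\<close> makes the order produced by
    \<open>sort_key\<close> strict.\<close>
  then have "sorted_wrt (<) (map g (sort_key g zs))" by (simp add: strict_sorted_iff)
  then show ?thesis using zs by (intro that[of "sort_key g zs"]) (auto simp: sorted_wrt_map)
qed

lemma optimal_cooperating_set_rightward:
  fixes pos :: "'v \<Rightarrow> real"
  assumes "finite relays" and "s \<notin> relays" and "d \<notin> relays"
    and "Imax > 0"
    and inj: "inj_on pos ({s, d} \<union> relays)"
    and "\<And>i j. i \<in> {s, d} \<union> relays \<Longrightarrow> j \<in> {s, d} \<union> relays \<Longrightarrow> i \<noteq> j \<Longrightarrow>
           C i j = f (dist (pos i) (pos j))"
    and "\<And>x. x > 0 \<Longrightarrow> f x \<ge> 0"
    and anti: "strict_antimono_on {0<..} f"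
    and "pos s < pos d"
  shows "optimal_cooperating_set relays s d C Imax R \<longleftrightarrow>
           R = {r \<in> relays. pos s < pos r \<and> pos r < pos d}"
proof -
  let ?B = "{r \<in> relays. pos s < pos r \<and> pos r < pos d}"
  have "finite ?B" "inj_on pos ?B" using assms(1) inj by (auto intro: inj_on_subset)
  then obtain ys where ys: "set ys = ?B" "sorted_wrt (\<lambda>x y. pos x < pos y) ys"
    by (rule ex_sorted_key)
  interpret line_network relays s d C Imax pos f ys
    using assms ys monotone_onD[OF anti] by unfold_locales auto
  show ?thesis using optimal_cooperating_set_iff ys by simp
qed

theorem lemma2:
  fixes relays :: "'v set" and s d :: 'v
    and C :: "'v \<Rightarrow> 'v \<Rightarrow> real" and Imax :: real
    and pos :: "'v \<Rightarrow> real" and f :: "real \<Rightarrow> real"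
  assumes "finite relays" and "s \<notin> relays" and "d \<notin> relays" and "s \<noteq> d"
    and "Imax > 0"
    and "inj_on pos ({s, d} \<union> relays)"
    and "\<And>i j. i \<in> {s, d} \<union> relays \<Longrightarrow> j \<in> {s, d} \<union> relays \<Longrightarrow> i \<noteq> j \<Longrightarrow>
           C i j = f (dist (pos i) (pos j))"
    and "\<And>x. x > 0 \<Longrightarrow> f x \<ge> 0"
    and "strict_antimono_on {0<..} f"
  shows "optimal_cooperating_set relays s d C Imax R \<longleftrightarrow>
           R = {r \<in> relays. pos r \<in> open_segment (pos s) (pos d)}"
proof (cases "pos s < pos d")
  case True
  then have "open_segment (pos s) (pos d) = {pos s<..<pos d}"
    by (simp add: open_segment_eq_real_ivl)
  then show ?thesis
    using optimal_cooperating_set_rightward[OF assms(1-3,5-9) True] by simp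
next
  case False
  have "pos s \<noteq> pos d" using assms(4,6) by (auto dest: inj_onD)
  then have less: "- pos s < - pos d" using False by simp
  \<comment> \<open>Reflecting the line preserves all distances, hence all capacities, and puts the
    source on the left.\<close>
  have "inj_on (\<lambda>x. - pos x) ({s, d} \<union> relays)" using assms(6) by (simp add: inj_on_def)
  moreover have "C i j = f (dist (- pos i) (- pos j))"
    if "i \<in> {s, d} \<union> relays" "j \<in> {s, d} \<union> relays" "i \<noteq> j" for i j
    using assms(7)[OF that] by (simp add: dist_minus)
  ultimately have "optimal_cooperating_set relays s d C Imax R \<longleftrightarrow>
      R = {r \<in> relays. - pos s < - pos r \<and> - pos r < - pos d}"
    using assms(1-3,5,8,9) less
    by (intro optimal_cooperating_set_rightward[where pos = "\<lambda>x. - pos x"]) auto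
  moreover have "open_segment (pos s) (pos d) = {pos d<..<pos s}"
    using False by (simp add: open_segment_eq_real_ivl)
  ultimately show ?thesis by (simp add: conj_commute)
qed

end
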